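(* Let $\mathbf X$ be a locally finite weakly systolic complex. Then any LexBFS ordering of the vertices of $\mathbf X$ (from any starting vertex) is a dismantling ordering of the $1$-skeleton $G(\mathbf X)$.
   Context: All graphs are undirected, connected, without loops or multiple edges; all simplicial complexes are flag (every set of vertices, each pair of which lies in a common simplex, is contained in a simplex) with connected $1$-skeleton. Distances, balls $B_r(v)$ and spheres $S_r(v)$ in $\mathbf X$ are those of its $1$-skeleton $G(\mathbf X)$ with the path metric. A flag complex $\mathbf X$ is weakly systolic if for every vertex $v$, every integer $i\ge 0$ and every nonempty simplex $\sigma$ with all vertices in $S_{i+1}(v)$, the set of vertices of $B_i(v)$ adjacent to all vertices of $\sigma$ spans a nonempty simplex. LexBFS ordering: choose a starting vertex $u=u_1$. Having visited $u_1,\dots,u_m$, the label of an unvisited vertex $w$ is the list of its visited neighbors, in order of visit; labels are compared lexicographically with earlier-visited vertices counting as larger, i.e. the label of $w$ is larger than the label of $w'$ if the labels differ and the earliest-visited vertex in the symmetric difference of the two labels belongs to the label of $w$. The next vertex $u_{m+1}$ is any unvisited vertex with the lexicographically largest label (ties broken arbitrarily). (In the finite case with $n$ vertices, the vertices are numbered in decreasing order: $u_1=v_n$, $u_2=v_{n-1}$, etc.) Dismantling ordering: writing the order of visit as $u_1,u_2,\dots$, it is dismantling if for every $m\ge 2$ there is $j<m$ such that $B_1(u_m)\cap\{u_1,\dots,u_m\}\subseteq B_1(u_j)\cap\{u_1,\dots,u_m\}$. For a finite graph with numbering $v_1,\dots,v_n$ this says: for each $i<n$ there is $j>i$ with $B_1(v_i)\cap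 V_i\subseteq B_1(v_j)\cap V_i$, where $V_i=\{v_i,\dots,v_n\}$. *)

theory Defs
  imports Main
begin

section \<open>Graphs\<close>

text \<open>A graph is a set \<open>V\<close> of vertices with an adjacency relation \<open>E\<close> on it. The graphs used here
  are 1-skeleta of simplicial complexes, whose adjacency is symmetric and irreflexive.\<close>

definition connected_graph :: "'a set \<Rightarrow> 'a rel \<Rightarrow> bool" where
  "connected_graph V E \<longleftrightarrow> (\<forall>x\<in>V. \<forall>y\<in>V. (x, y) \<in> E\<^sup>*)"

text \<open>The path metric; only meaningful for two vertices joined by a path.\<close>

definition gdist :: "'a rel \<Rightarrow> 'a \<Rightarrow> 'a \<Rightarrow> nat" where
  "gdist E x y = (LEAST n. (x, y) \<in> E ^^ n)"

definition gball :: "'a set \<Rightarrow> 'a rel \<Rightarrow> nat \<Rightarrow> 'a \<Rightarrow> 'a set" where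
  "gball V E r v = {w \<in> V. gdist E v w \<le> r}"

definition gsphere :: "'a set \<Rightarrow> 'a rel \<Rightarrow> nat \<Rightarrow> 'a \<Rightarrow> 'a set" where
  "gsphere V E r v = {w \<in> V. gdist E v w = r}"

section \<open>Simplicial complexes\<close>

text \<open>A simplicial complex is given by its set of simplices, each identified with its finite set of
  vertices. The empty simplex is allowed.\<close>

definition simplicial_complex :: "'a set set \<Rightarrow> bool" where
  "simplicial_complex X \<longleftrightarrow>
     (\<forall>\<sigma>\<in>X. finite \<sigma>) \<and> (\<forall>\<sigma>\<in>X. \<forall>\<tau>. \<tau> \<subseteq> \<sigma> \<longrightarrow> \<tau> \<in> X)"

definition vertices :: "'a set set \<Rightarrow> 'a set" where
  "vertices X = \<Union>X"

definition skeleton1 :: "'a set set \<Rightarrow> 'a rel" where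
  "skeleton1 X = {(x, y). x \<noteq> y \<and> {x, y} \<in> X}"

definition flag_complex :: "'a set set \<Rightarrow> bool" where
  "flag_complex X \<longleftrightarrow> simplicial_complex X \<and>
     (\<forall>A \<subseteq> vertices X. (\<forall>x\<in>A. \<forall>y\<in>A. \<exists>\<sigma>\<in>X. x \<in> \<sigma> \<and> y \<in> \<sigma>) \<longrightarrow> (\<exists>\<sigma>\<in>X. A \<subseteq> \<sigma>))"

definition locally_finite_complex :: "'a set set \<Rightarrow> bool" where
  "locally_finite_complex X \<longleftrightarrow> (\<forall>v \<in> vertices X. finite {\<sigma> \<in> X. v \<in> \<sigma>})"

definition weakly_systolic :: "'a set set \<Rightarrow> bool" where
  "weakly_systolic X \<longleftrightarrow>
     flag_complex X \<and> connected_graph (vertices X) (skeleton1 X) \<and>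
     (\<forall>v \<in> vertices X. \<forall>i. \<forall>\<sigma>\<in>X.
        \<sigma> \<noteq> {} \<and> \<sigma> \<subseteq> gsphere (vertices X) (skeleton1 X) (i + 1) v \<longrightarrow>
        (let T = {w \<in> gball (vertices X) (skeleton1 X) i v. \<forall>x\<in>\<sigma>. (w, x) \<in> skeleton1 X}
         in T \<noteq> {} \<and> T \<in> X))"

section \<open>Vertex orderings\<close>

text \<open>An ordering of \<open>V\<close> is a sequence \<open>u 0, u 1, \<dots>\<close> indexed from 0, with \<open>card V\<close> entries if \<open>V\<close> is
  finite and infinitely many otherwise. Values of \<open>u\<close> outside the following index set are
  irrelevant.\<close>

definition positions :: "'a set \<Rightarrow> nat set" where
  "positions V = {i. finite V \<longrightarrow> i < card V}"

text \<open>The label of \<open>w\<close> when exactly \<open>u 0, \<dots>, u (m - 1)\<close> have been visited.\<close>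

definition lexbfs_label :: "'a rel \<Rightarrow> (nat \<Rightarrow> 'a) \<Rightarrow> nat \<Rightarrow> 'a \<Rightarrow> 'a list" where
  "lexbfs_label E u m w = filter (\<lambda>x. (x, w) \<in> E) (map u [0..<m])"

text \<open>Here \<open>u k\<close> is the earliest-visited vertex in the symmetric difference of the two labels.\<close>

definition label_larger :: "(nat \<Rightarrow> 'a) \<Rightarrow> 'a list \<Rightarrow> 'a list \<Rightarrow> bool" where
  "label_larger u L L' \<longleftrightarrow>
     (\<exists>k. u k \<in> set L \<and> u k \<notin> set L' \<and> (\<forall>i<k. u i \<in> set L \<longleftrightarrow> u i \<in> set L'))"

text \<open>At \<open>m = 0\<close> all labels are empty, so the starting vertex is arbitrary. It is not required that
  an infinite search reaches every vertex.\<close>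

definition lexbfs_ordering :: "'a set \<Rightarrow> 'a rel \<Rightarrow> (nat \<Rightarrow> 'a) \<Rightarrow> bool" where
  "lexbfs_ordering V E u \<longleftrightarrow>
     (\<forall>m \<in> positions V. u m \<in> V - u ` {..<m} \<and>
        (\<forall>w \<in> V - u ` {..<m}.
           lexbfs_label E u m w = lexbfs_label E u m (u m) \<or>
           label_larger u (lexbfs_label E u m (u m)) (lexbfs_label E u m w)))"

definition dismantling_ordering :: "'a set \<Rightarrow> 'a rel \<Rightarrow> (nat \<Rightarrow> 'a) \<Rightarrow> bool" where
  "dismantling_ordering V E u \<longleftrightarrow>
     bij_betw u (positions V) V \<and>
     (\<forall>m \<in> positions V. m \<ge> 1 \<longrightarrow>
        (\<exists>j<m. gball V E 1 (u m) \<inter> u ` {..m} \<subseteq> gball V E 1 (u j) \<inter> u ` {..m}))"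

end

theory Submission
  imports Defs
begin

text \<open>In a LexBFS ordering the earliest neighbour \<open>f v\<close> of \<open>v\<close> dominates \<open>v\<close> among the vertices
  visited so far. Assume this fails for \<open>v\<close>, with all earlier vertices dominated, and let \<open>w\<close> be the
  first earlier neighbour of \<open>v\<close> not adjacent to \<open>a = f v\<close>. Both \<open>v\<close> and \<open>w\<close> lie in \<open>S\<^sub>k\<^sub>+\<^sub>1\<close>, and
  \<open>b = f w\<close> is earlier than and not adjacent to \<open>a\<close>. Let \<open>s\<close> be the earliest common neighbour
  of \<open>v\<close> and \<open>w\<close> in \<open>S\<^sub>k\<close>, and \<open>y\<close> the earliest vertex that does not relate in the same way to
  \<open>a\<close>, \<open>b\<close>, \<open>s\<close>; since \<open>b\<close>, \<open>a\<close>, \<open>s\<close> are visited in this order and there is no induced 4-cycle, \<open>y\<close>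
  is adjacent to \<open>b\<close> only. Seen from \<open>y\<close>, the vertices \<open>a\<close> and \<open>w\<close> are nonadjacent neighbours of
  \<open>v\<close> at distance at most 2, so \<open>y\<close> and \<open>v\<close> have a common neighbour \<open>z\<close>. It turns out to be a common
  neighbour of \<open>v\<close> and \<open>w\<close> in \<open>S\<^sub>k\<close> that should have been visited before \<open>s\<close>.\<close>

section \<open>Graphs numbered by LexBFS\<close>

text \<open>Vertices are replaced by their positions of visit, so \<open><\<close> is the order of
  visit and the search starts at \<open>0\<close>. \<open>clique\<close> and \<open>triangle\<close>
  are the weakly systolic condition for a single vertex and for an edge; \<open>lexbfs\<close>
  compares labels at the time \<open>p\<close> is chosen and \<open>q\<close> is still
  unvisited.\<close>

locale lexbfs_graph =
  fixes P :: "nat set" and adj :: "nat \<Rightarrow> nat \<Rightarrow> bool" and d :: "nat \<Rightarrow> nat \<Rightarrow> nat"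
  assumes zero_P: "0 \<in> P"
    and adj_sym: "adj x y \<Longrightarrow> adj y x"
    and adj_irrefl: "\<not> adj x x"
    and adj_P: "adj x y \<Longrightarrow> x \<in> P"
    and d_refl: "d x x = 0"
    and d_eq_0: "\<lbrakk>x \<in> P; y \<in> P; d x y = 0\<rbrakk> \<Longrightarrow> x = y"
    and d_step: "\<lbrakk>v \<in> P; adj x y\<rbrakk> \<Longrightarrow> d v y \<le> d v x + 1"
    and d_pred: "\<lbrakk>v \<in> P; x \<in> P; d v x = Suc i\<rbrakk> \<Longrightarrow> \<exists>p. adj p x \<and> d v p = i"
    and clique: "\<lbrakk>v \<in> P; d v x = Suc i; adj p x; adj q x; d v p \<le> i; d v q \<le> i\<rbrakk>
      \<Longrightarrow> p = q \<or> adj p q"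
    and triangle: "\<lbrakk>v \<in> P; adj x y; d v x = Suc i; d v y = Suc i\<rbrakk>
      \<Longrightarrow> \<exists>p. adj p x \<and> adj p y \<and> d v p \<le> i"
    and lexbfs: "\<lbrakk>p \<in> P; p < q; i < p; adj i q; \<not> adj i p\<rbrakk> \<Longrightarrow> \<exists>k<i. adj k p \<and> \<not> adj k q"
begin

lemma adj_P2: "adj x y \<Longrightarrow> y \<in> P"
  using adj_sym adj_P by blast

lemma d_le_1:
  assumes "x \<in> P" "y \<in> P" "d x y \<le> 1"
  shows "x = y \<or> adj x y"
proof (cases "d x y = 0")
  case True
  then show ?thesis using d_eq_0 assms by blast
next
  case False
  then have "d x y = Suc 0" using assms by simp
  then obtain p where "adj p y" "d x p = 0" using d_pred assms by blast
  then show ?thesis using d_eq_0 adj_P assms by blast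
qed

text \<open>Otherwise \<open>d p r = 2\<close>, and \<open>clique\<close> based at \<open>p\<close>
  joins the neighbours \<open>q\<close> and \<open>s\<close> of \<open>r\<close>.\<close>

lemma no_induced_4_cycle:
  assumes "adj p q" "adj q r" "adj r s" "adj s p" "p \<noteq> r" "q \<noteq> s"
  shows "adj p r \<or> adj q s"
proof (rule ccontr)
  assume neg: "\<not> (adj p r \<or> adj q s)"
  have p: "p \<in> P" and r: "r \<in> P" using assms adj_P by blast+
  have q1: "d p q \<le> 1" using d_step[OF p assms(1)] d_refl by simp
  have s1: "d p s \<le> 1" using d_step[OF p adj_sym[OF assms(4)]] d_refl by simp
  have "d p r \<le> 2" using d_step[OF p assms(2)] q1 by simp
  moreover have "\<not> d p r \<le> 1" using d_le_1[OF p r] neg assms by blast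
  ultimately have "d p r = Suc 1" by simp
  then show False
    using clique[OF p _ assms(2) adj_sym[OF assms(3)] q1 s1] neg assms by blast
qed

section \<open>Earliest neighbours and distance levels\<close>

definition father :: "nat \<Rightarrow> nat" where
  "father q = (LEAST j. adj j q)"

lemma father_le: "adj j q \<Longrightarrow> father q \<le> j"
  unfolding father_def by (rule Least_le)

lemma adj_father: "adj j q \<Longrightarrow> adj (father q) q"
  unfolding father_def by (rule LeastI)

text \<open>Among the positions from \<open>p\<close> on, let \<open>q\<close> be closest to
  \<open>0\<close>; its neighbour \<open>j\<close> one level down then lies before \<open>p\<close>.
  If \<open>p\<close> had no earlier neighbour, \<open>j\<close> would favour \<open>q\<close> over
  \<open>p\<close>, against \<open>lexbfs\<close>.\<close>

lemma earlier_neighbour: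
  assumes "p \<in> P" "p \<noteq> 0"
  shows "\<exists>j<p. adj j p"
proof (rule ccontr)
  assume neg: "\<not> (\<exists>j<p. adj j p)"
  obtain q where q: "q \<in> P" "q \<ge> p" and qmin: "\<And>r. r \<in> P \<Longrightarrow> r \<ge> p \<Longrightarrow> d 0 q \<le> d 0 r"
    using assms ex_has_least_nat[of "\<lambda>q. q \<in> P \<and> q \<ge> p" p "d 0"] by blast
  have "d 0 q \<noteq> 0" using d_eq_0[OF zero_P q(1)] q(2) assms(2) by auto
  then obtain i where i: "d 0 q = Suc i" using not0_implies_Suc by blast
  obtain j where j: "adj j q" "d 0 j = i" using d_pred[OF zero_P q(1) i] by blast
  have "j < p" using qmin[of j] j i adj_P by force
  then show False
    using lexbfs[OF assms(1) _ \<open>j < p\<close> j(1)] neg q(2) \<open>d 0 q \<noteq> 0\<close> j \<open>j < p\<close>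
    by (cases "q = p") (auto dest: less_trans)
qed

lemma father:
  assumes "p \<in> P" "p \<noteq> 0"
  shows "adj (father p) p" "father p < p"
proof -
  obtain j where "j < p" "adj j p" using earlier_neighbour assms by blast
  then show "adj (father p) p" "father p < p" using adj_father father_le by (blast, fastforce)
qed

text \<open>If \<open>father q\<close> came before \<open>father p\<close>, it would favour
  \<open>q\<close>, and \<open>lexbfs\<close> would give \<open>p\<close> a neighbour earlier
  still.\<close>

lemma father_mono:
  assumes "p \<in> P" "q \<in> P" "p \<noteq> 0" "p \<le> q"
  shows "father p \<le> father q"
proof (rule ccontr)
  assume neg: "\<not> father p \<le> father q"
  have q: "adj (father q) q" using father assms by fastforce
  have "\<not> adj (father q) p" using neg father_le by blast
  moreover have "father q < p" using neg father(2)[OF assms(1,3)] by simp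
  moreover have "p < q" using neg assms(4) by (cases "p = q") auto
  ultimately obtain k where "k < father q" "adj k p"
    using lexbfs[OF assms(1) _ _ q] by blast
  then show False using father_le neg by fastforce
qed

text \<open>LexBFS is a breadth-first search. For \<open>r\<close> of least level from
  \<open>q\<close> on and \<open>x\<close> one level below \<open>r\<close>, monotonicity of fathers
  gives \<open>father q \<le> x\<close>, and the induction hypothesis at \<open>father q\<close>
  bounds the level of \<open>q\<close> by that of \<open>r\<close>.\<close>

lemma level_mono: "\<lbrakk>q \<in> P; j \<in> P; q \<le> j\<rbrakk> \<Longrightarrow> d 0 q \<le> d 0 j"
proof (induction q arbitrary: j rule: less_induct)
  case (less q)
  show ?case
  proof (cases "q = 0")
    case True
    then show ?thesis using d_refl by simp
  next
    case False
    obtain r where r: "r \<in> P" "r \<ge> q" and rmin: "\<And>x. x \<in> P \<Longrightarrow> x \<ge> q \<Longrightarrow> d 0 r \<le> d 0 x"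
      using less.prems ex_has_least_nat[of "\<lambda>x. x \<in> P \<and> x \<ge> q" q "d 0"] by blast
    have "d 0 r \<noteq> 0" using d_eq_0[OF zero_P r(1)] r(2) False by auto
    then obtain i where i: "d 0 r = Suc i" using not0_implies_Suc by blast
    obtain x where x: "adj x r" "d 0 x = i" using d_pred[OF zero_P r(1) i] by blast
    have "father q \<le> x"
      using father_mono[OF less.prems(1) r(1) False r(2)] father_le[OF x(1)] by simp
    then have "d 0 (father q) \<le> d 0 x"
      using less.IH father[OF less.prems(1) False] adj_P x(1) by blast
    then have "d 0 q \<le> d 0 r"
      using d_step[OF zero_P father(1)[OF less.prems(1) False]] x(2) i by simp
    then show ?thesis using rmin[of j] less.prems by simp
  qed
qed

text \<open>The father is no later than any neighbour one level down, so by
  \<open>level_mono\<close> its level is no higher.\<close>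

lemma level_father:
  assumes "p \<in> P" "p \<noteq> 0"
  shows "d 0 p = Suc (d 0 (father p))"
proof -
  have "d 0 p \<noteq> 0" using d_eq_0[OF zero_P assms(1)] assms(2) by auto
  then obtain i where i: "d 0 p = Suc i" using not0_implies_Suc by blast
  then obtain j where j: "adj j p" "d 0 j = i" using d_pred[OF zero_P assms(1)] by blast
  have f: "adj (father p) p" using father assms by blast
  have "d 0 (father p) \<le> i"
    using level_mono[of "father p" j] father_le[OF j(1)] adj_P j f by blast
  then show ?thesis using d_step[OF zero_P f] i by simp
qed

lemma lower_neighbours:
  assumes "d 0 x = Suc i" "adj p x" "adj q x" "d 0 p \<le> i" "d 0 q \<le> i"
  shows "p = q \<or> adj p q"
  using clique[OF zero_P] assms by blast

text \<open>If \<open>m\<close> were adjacent to \<open>q\<close> only, \<open>lexbfs\<close> would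
  produce an earlier difference.\<close>

lemma lexbfs_first_difference:
  assumes "p \<in> P" "p < q" "m < p" "adj m p \<noteq> adj m q" "\<And>i. i < m \<Longrightarrow> adj i p = adj i q"
  shows "adj m p \<and> \<not> adj m q"
  using lexbfs[OF assms(1,2,3)] assms(4,5) by blast

theorem father_dominates:
  "\<lbrakk>v \<in> P; i < v; adj i v\<rbrakk> \<Longrightarrow> i = father v \<or> adj i (father v)"
proof (induction v arbitrary: i rule: less_induct)
  case (less v)
  have IH: "j = father x \<or> adj j (father x)" if "x < v" "j < x" "adj j x" for x j
    using less.IH[OF that(1) adj_P2 that(2,3)] that(3) by blast
  define bad where "bad j \<longleftrightarrow> j < v \<and> adj j v \<and> j \<noteq> father v \<and> \<not> adj j (father v)" for j
  have "\<not> bad j" for j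
  proof
    assume "bad j"
    define w where "w = (LEAST j. bad j)"
    have "bad w" unfolding w_def using \<open>bad j\<close> by (rule LeastI)
    have w_least: "\<not> bad j" if "j < w" for j
      using that not_less_Least unfolding w_def by blast
    define a where "a = father v"
    define b where "b = father w"
    have wv: "w < v" "adj w v" "w \<noteq> a" "\<not> adj w a"
      using \<open>bad w\<close> unfolding bad_def a_def by auto
    have wP: "w \<in> P" and vP: "v \<in> P" using adj_P adj_P2 wv by blast+
    have v0: "v \<noteq> 0" using wv by simp
    have av: "adj a v" and "a < v" using father[OF vP v0] a_def by auto
    have aP: "a \<in> P" using adj_P av by blast
    define k where "k = d 0 a"
    have dv: "d 0 v = Suc k" using level_father[OF vP v0] unfolding k_def a_def .
    \<comment> \<open>Were \<open>w\<close> lower, \<open>w\<close> and \<open>a\<close> would be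
      lower neighbours of \<open>v\<close>, hence equal or adjacent.\<close>
    have dw: "d 0 w = Suc k"
    proof -
      have "\<not> d 0 w \<le> k"
        using lower_neighbours[OF dv wv(2) av] wv unfolding k_def by auto
      moreover have "d 0 w \<le> Suc k" using level_mono[OF wP vP] wv(1) dv by simp
      ultimately show ?thesis by simp
    qed
    have w0: "w \<noteq> 0" using dw d_refl by (metis Zero_not_Suc)
    have bw: "adj b w" and "b < w" using father[OF wP w0] b_def by auto
    have bP: "b \<in> P" using adj_P bw by blast
    have db: "d 0 b = k" using level_father[OF wP w0] dw b_def by simp
    have "b \<le> a" unfolding a_def b_def using father_mono[OF wP vP w0] wv(1) by simp
    moreover have "b \<noteq> a" using bw wv(4) adj_sym by blast
    ultimately have ba: "b < a" by simp
    have not_before_a: "\<not> adj x v" if "x < a" for x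
      using father_le[of x v] that unfolding a_def by auto
    have nbv: "\<not> adj b v" using not_before_a ba .
    \<comment> \<open>Otherwise \<open>v\<close>, \<open>a\<close>, \<open>b\<close>,
      \<open>w\<close> form an induced 4-cycle.\<close>
    have nab: "\<not> adj a b"
    proof
      assume ab: "adj a b"
      have "v \<noteq> b" using \<open>b < w\<close> wv(1) by simp
      then show False
        using no_induced_4_cycle[OF adj_sym[OF av] ab bw wv(2)] wv(3,4) nbv adj_sym by blast
    qed
    define common where "common x \<longleftrightarrow> adj x v \<and> adj x w \<and> d 0 x \<le> k" for x
    have "\<exists>x. common x"
      using triangle[OF zero_P wv(2) dw dv] unfolding common_def by blast
    define s where "s = (LEAST x. common x)"
    have "common s" unfolding s_def using \<open>\<exists>x. common x\<close> by (rule LeastI_ex)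
    then have sv: "adj s v" and sw: "adj s w" and ds': "d 0 s \<le> k"
      unfolding common_def by auto
    have sP: "s \<in> P" using adj_P sv by blast
    have s_least: "s \<le> x" if "common x" for x
      unfolding s_def using that by (rule Least_le)
    have "s \<noteq> a" "s \<noteq> b" using sw sv wv nbv adj_sym by blast+
    have sa: "adj s a"
      using lower_neighbours[OF dv sv av ds'] k_def \<open>s \<noteq> a\<close> by simp
    have sb: "adj s b"
      using lower_neighbours[OF dw sw bw ds'] db \<open>s \<noteq> b\<close> by simp
    have as: "a < s" using not_before_a sv \<open>s \<noteq> a\<close> nat_neq_iff by blast
    have ds: "d 0 s = k" using ds' level_mono[OF aP sP] as k_def by simp
    have "s < v"
      using level_mono[OF vP sP] ds dv by (metis not_less Suc_n_not_le_n)
    have "b < v" using \<open>b < w\<close> wv(1) by simp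
    define differ where
      "differ x \<longleftrightarrow> \<not> (adj x a \<longleftrightarrow> adj x b) \<or> \<not> (adj x a \<longleftrightarrow> adj x s)" for x
    define y where "y = (LEAST x. differ x)"
    \<comment> \<open>\<open>b\<close> is adjacent to \<open>s\<close> but not to \<open>a\<close>,
      so \<open>y\<close> exists and is at most \<open>b\<close>.\<close>
    have "differ b" unfolding differ_def using sb nab adj_sym adj_irrefl by blast
    then have "differ y" unfolding y_def by (rule LeastI)
    have agree: "adj x a = adj x b" "adj x a = adj x s" if "x < y" for x
      using not_less_Least[of x differ] that unfolding y_def differ_def by auto
    have "y \<le> b" unfolding y_def using \<open>differ b\<close> by (rule Least_le)
    have "y \<noteq> b"
    proof
      assume "y = b"
      then have "adj b a \<and> \<not> adj b s"
        using lexbfs_first_difference[OF aP as ba] agree sb nab adj_sym by blast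
      then show False using nab adj_sym by blast
    qed
    then have yb: "y < b" using \<open>y \<le> b\<close> by simp
    \<comment> \<open>At a first difference the earlier vertex has the adjacency, so along
      \<open>b\<close>, \<open>a\<close>, \<open>s\<close> adjacency to \<open>y\<close> can only be
      lost.\<close>
    have pattern: "adj y b \<and> \<not> adj y s"
    proof -
      have "adj y b \<and> \<not> adj y a" if "adj y b \<noteq> adj y a"
        using lexbfs_first_difference[OF bP ba yb that] agree by blast
      moreover have "adj y a \<and> \<not> adj y s" if "adj y a \<noteq> adj y s"
        using lexbfs_first_difference[OF aP as _ that] yb ba agree by simp
      ultimately show ?thesis using \<open>differ y\<close> unfolding differ_def by blast
    qed
    then have adj_yb: "adj y b" and nys: "\<not> adj y s" by auto
    \<comment> \<open>Otherwise \<open>y\<close>, \<open>a\<close>, \<open>s\<close>,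
      \<open>b\<close> form an induced 4-cycle.\<close>
    have nya: "\<not> adj y a"
    proof
      assume ya: "adj y a"
      have "y \<noteq> s" "a \<noteq> b" using ba yb as by auto
      then show False
        using no_induced_4_cycle[OF ya adj_sym[OF sa] sb adj_sym[OF adj_yb]] nys nab by blast
    qed
    have yP: "y \<in> P" using adj_P adj_yb by blast
    have nyv: "\<not> adj y v" using not_before_a yb ba by simp
    have b0: "b \<noteq> 0" and s0: "s \<noteq> 0" using yb as by auto
    have dy: "d 0 y \<le> k" using level_mono[OF yP bP] yb db by simp
    \<comment> \<open>This \<open>t\<close> serves to place \<open>a\<close> within distance 2 of
      \<open>y\<close>.\<close>
    obtain t where t: "adj t a" "adj t y"
    proof (cases "d 0 y = k")
      case True
      \<comment> \<open>The induction hypothesis at \<open>b\<close> joins \<open>father b\<close>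
        to \<open>y\<close>; being before \<open>y\<close> and adjacent to \<open>b\<close>, it is
        also adjacent to \<open>a\<close>.\<close>
      let ?t = "father b"
      have tb: "adj ?t b" using father[OF bP b0] by simp
      have dt: "Suc (d 0 ?t) = k" using level_father[OF bP b0] db by simp
      have ty: "?t \<noteq> y" using dt True by auto
      then have "adj ?t y"
        using IH[OF \<open>b < v\<close> yb adj_yb] adj_sym by blast
      moreover have "?t < y"
        using father_le[OF adj_yb] ty by simp
      then have "adj ?t a" using agree tb by blast
      ultimately show ?thesis using that by blast
    next
      case False
      \<comment> \<open>The induction hypothesis at \<open>s\<close> joins \<open>father s\<close>
        to \<open>a\<close> and \<open>b\<close>. Now \<open>y\<close> lies below level
        \<open>k\<close>, so \<open>father s\<close> and \<open>y\<close> are lower neighbours of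
        \<open>b\<close>.\<close>
      let ?t = "father s"
      have ts: "adj ?t s" using father[OF sP s0] by simp
      have dt: "Suc (d 0 ?t) = k" using level_father[OF sP s0] ds by simp
      have "a \<noteq> ?t" "b \<noteq> ?t" using dt db k_def by auto
      then have ta: "adj ?t a" and tb: "adj ?t b"
        using IH[OF \<open>s < v\<close> as adj_sym[OF sa]] IH[OF \<open>s < v\<close> _ adj_sym[OF sb]] as ba adj_sym
        by auto
      have "?t = y \<or> adj ?t y"
        using lower_neighbours[of b "d 0 ?t" ?t y] dt db tb adj_yb dy False by simp
      then have "adj ?t y" using ts nys by blast
      then show ?thesis using that ta by blast
    qed
    \<comment> \<open>At distance 3, \<open>clique\<close> based at \<open>y\<close> would make
      \<open>w\<close> and \<open>a\<close> adjacent.\<close>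
    have "d y v \<le> 2"
    proof (rule ccontr)
      assume far: "\<not> d y v \<le> 2"
      have "d y b \<le> 1" using d_step[OF yP adj_yb] d_refl by simp
      then have yw: "d y w \<le> 2" using d_step[OF yP bw] by simp
      have "d y t \<le> 1" using d_step[OF yP adj_sym[OF t(2)]] d_refl by simp
      then have ya: "d y a \<le> 2" using d_step[OF yP t(1)] by simp
      have "d y v = Suc 2" using d_step[OF yP wv(2)] yw far by simp
      then show False using clique[OF yP _ wv(2) av yw ya] wv by blast
    qed
    moreover have "\<not> d y v \<le> 1"
      using d_le_1[OF yP vP] nyv yb ba \<open>a < v\<close> by auto
    ultimately have "d y v = Suc 1" by simp
    then obtain z where z: "adj z v" "d y z = 1" using d_pred[OF yP vP] by blast
    have zP: "z \<in> P" using adj_P z by blast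
    have yz: "adj y z" using d_le_1[OF yP zP] z d_refl by force
    \<comment> \<open>If \<open>z\<close> were on level \<open>k + 1\<close>, its father would
      precede \<open>b = father w\<close>, so \<open>z < w\<close> and \<open>z\<close> would not be
      bad. Then \<open>y\<close> and \<open>a\<close> would be lower neighbours of \<open>z\<close>,
      hence adjacent.\<close>
    have dz: "d 0 z \<le> k"
    proof (rule ccontr)
      assume "\<not> d 0 z \<le> k"
      then have dz: "d 0 z = Suc k" using d_step[OF zero_P yz] dy by simp
      have "z < w"
      proof (rule ccontr)
        assume "\<not> z < w"
        then have "father w \<le> father z" using father_mono[OF wP zP w0] by simp
        then show False using father_le[OF yz] yb b_def by simp
      qed
      then have "z = a \<or> adj z a"
        using w_least[of z] z(1) wv(1) unfolding bad_def a_def by auto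
      then have "adj z a" using dz k_def by auto
      then have "y = a \<or> adj y a"
        using lower_neighbours[OF dz yz] adj_sym dy k_def by simp
      then show False using nya yb ba by simp
    qed
    have "z \<noteq> a" "z \<noteq> s" "z \<noteq> b" using yz nya nys nbv z(1) by blast+
    have za: "adj z a" using lower_neighbours[OF dv z(1) av dz] k_def \<open>z \<noteq> a\<close> by simp
    have zs: "adj z s" using lower_neighbours[OF dv z(1) sv dz ds'] \<open>z \<noteq> s\<close> by simp
    have "y \<noteq> s" using yb ba as by simp
    then have zb: "adj z b"
      using no_induced_4_cycle[OF zs sb adj_sym[OF adj_yb] yz \<open>z \<noteq> b\<close>] nys adj_sym by blast
    have "z \<noteq> w" using dz dw by auto
    then have zw: "adj z w"
      using no_induced_4_cycle[OF z(1) adj_sym[OF wv(2)] adj_sym[OF bw] adj_sym[OF zb]]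
        nbv adj_sym \<open>b < v\<close> by blast
    have "s \<le> z" using s_least z(1) zw dz unfolding common_def by blast
    then have "s < z" using \<open>z \<noteq> s\<close> by simp
    \<comment> \<open>\<open>y\<close> favours \<open>z\<close> over the earlier \<open>s\<close>,
      so something before \<open>y\<close> favours \<open>s\<close>. By the choice of
      \<open>y\<close>, this \<open>q\<close> is also adjacent to \<open>a\<close> and
      \<open>b\<close>, and \<open>q\<close>, \<open>a\<close>, \<open>z\<close>, \<open>b\<close>
      form an induced 4-cycle.\<close>
    then obtain q where q: "q < y" "adj q s" "\<not> adj q z"
      using lexbfs[OF sP _ _ yz nys] yb ba as by auto
    have qa: "adj q a" and qb: "adj q b" using agree q by blast+
    have "q \<noteq> z" "a \<noteq> b" using ba yb as \<open>s < z\<close> q(1) by auto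
    then show False
      using no_induced_4_cycle[OF qa adj_sym[OF za] zb adj_sym[OF qb]] q(3) nab by blast
  qed
  then show ?case using less.prems unfolding bad_def by blast
qed

end

section \<open>The path metric of a weakly systolic complex\<close>

lemma gdist_le: "(x, y) \<in> E ^^ n \<Longrightarrow> gdist E x y \<le> n"
  unfolding gdist_def by (rule Least_le)

lemma relpow_gdist:
  assumes "(x, y) \<in> E\<^sup>*"
  shows "(x, y) \<in> E ^^ gdist E x y"
proof -
  obtain n where "(x, y) \<in> E ^^ n" using assms rtrancl_imp_relpow by blast
  then show ?thesis unfolding gdist_def by (rule LeastI)
qed

lemma gdist_refl: "gdist E x x = 0"
  using gdist_le[of x x 0 E] by simp

lemma gdist_eq_0D: "(x, y) \<in> E\<^sup>* \<Longrightarrow> gdist E x y = 0 \<Longrightarrow> x = y"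
  using relpow_gdist by fastforce

lemma gdist_adj: "(x, y) \<in> E \<Longrightarrow> gdist E x y \<le> 1"
  using gdist_le[of x y 1 E] by simp

lemma gdist_step:
  assumes "(v, x) \<in> E\<^sup>*" "(x, y) \<in> E"
  shows "gdist E v y \<le> gdist E v x + 1"
  using gdist_le[of v y "Suc (gdist E v x)" E] relpow_gdist[OF assms(1)] assms(2) by auto

lemma gdist_pred:
  assumes "(v, x) \<in> E\<^sup>*" "gdist E v x = Suc i"
  shows "\<exists>p. (p, x) \<in> E \<and> gdist E v p = i"
proof -
  have "(v, x) \<in> E ^^ Suc i" using relpow_gdist[OF assms(1)] assms(2) by simp
  then obtain p where p: "(v, p) \<in> E ^^ i" "(p, x) \<in> E" by auto
  have "(v, p) \<in> E\<^sup>*" using p(1) relpow_imp_rtrancl by blast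
  then have "gdist E v x \<le> gdist E v p + 1" using p(2) by (rule gdist_step)
  then show ?thesis using gdist_le[OF p(1)] p(2) assms(2) by (intro exI[of _ p]) simp
qed

section \<open>The 1-skeleton and the weakly systolic condition at vertices and edges\<close>

lemma skeleton1_sym: "(x, y) \<in> skeleton1 X \<Longrightarrow> (y, x) \<in> skeleton1 X"
  unfolding skeleton1_def by (auto simp: insert_commute)

lemma skeleton1_irrefl: "(x, x) \<notin> skeleton1 X"
  unfolding skeleton1_def by simp

lemma skeleton1_vertices: "(x, y) \<in> skeleton1 X \<Longrightarrow> x \<in> vertices X"
  unfolding skeleton1_def vertices_def by auto

lemma weakly_systolic_subset:
  "weakly_systolic X \<Longrightarrow> \<sigma> \<in> X \<Longrightarrow> \<tau> \<subseteq> \<sigma> \<Longrightarrow> \<tau> \<in> X"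
  unfolding weakly_systolic_def flag_complex_def simplicial_complex_def by blast

lemma weakly_systolic_connected:
  "weakly_systolic X \<Longrightarrow> x \<in> vertices X \<Longrightarrow> y \<in> vertices X \<Longrightarrow> (x, y) \<in> (skeleton1 X)\<^sup>*"
  unfolding weakly_systolic_def connected_graph_def by blast

lemma weakly_systolic_common_neighbours:
  assumes "weakly_systolic X" "v \<in> vertices X" "\<sigma> \<in> X" "\<sigma> \<noteq> {}"
    and "\<sigma> \<subseteq> gsphere (vertices X) (skeleton1 X) (i + 1) v"
  defines "T \<equiv> {w \<in> gball (vertices X) (skeleton1 X) i v. \<forall>x\<in>\<sigma>. (w, x) \<in> skeleton1 X}"
  shows "T \<noteq> {}" "T \<in> X"
proof -
  have "\<forall>v \<in> vertices X. \<forall>i. \<forall>\<sigma>\<in>X.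
    \<sigma> \<noteq> {} \<and> \<sigma> \<subseteq> gsphere (vertices X) (skeleton1 X) (i + 1) v \<longrightarrow>
    (let T = {w \<in> gball (vertices X) (skeleton1 X) i v. \<forall>x\<in>\<sigma>. (w, x) \<in> skeleton1 X}
     in T \<noteq> {} \<and> T \<in> X)"
    using assms(1) unfolding weakly_systolic_def by (elim conjE)
  note this[rule_format, OF assms(2,3) conjI[OF assms(4,5)]]
  then show "T \<noteq> {}" "T \<in> X" unfolding T_def Let_def by (rule conjunct1, rule conjunct2)
qed

text \<open>For the simplex \<open>{x}\<close>, the neighbours of \<open>x\<close> in the smaller
  ball span a simplex, which contains \<open>p\<close> and \<open>q\<close>.\<close>

lemma weakly_systolic_clique:
  assumes X: "weakly_systolic X" and v: "v \<in> vertices X"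
    and "gdist (skeleton1 X) v x = Suc i"
    and px: "(p, x) \<in> skeleton1 X" and qx: "(q, x) \<in> skeleton1 X"
    and "gdist (skeleton1 X) v p \<le> i" "gdist (skeleton1 X) v q \<le> i"
  shows "p = q \<or> (p, q) \<in> skeleton1 X"
proof -
  let ?T = "{w \<in> gball (vertices X) (skeleton1 X) i v. \<forall>y\<in>{x}. (w, y) \<in> skeleton1 X}"
  have xV: "x \<in> vertices X" using px skeleton1_sym skeleton1_vertices by metis
  then have "{x} \<in> X"
    using weakly_systolic_subset[OF X] unfolding vertices_def by fastforce
  moreover have "{x} \<subseteq> gsphere (vertices X) (skeleton1 X) (i + 1) v"
    using assms xV unfolding gsphere_def by simp
  ultimately have "?T \<in> X"
    by (intro weakly_systolic_common_neighbours[OF X v]) auto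
  moreover have "{p, q} \<subseteq> ?T"
    using assms skeleton1_vertices unfolding gball_def by fastforce
  ultimately have "{p, q} \<in> X" using weakly_systolic_subset[OF X] by blast
  then show ?thesis unfolding skeleton1_def by blast
qed

lemma weakly_systolic_triangle:
  assumes X: "weakly_systolic X" and v: "v \<in> vertices X"
    and xy: "(x, y) \<in> skeleton1 X"
    and "gdist (skeleton1 X) v x = Suc i" "gdist (skeleton1 X) v y = Suc i"
  shows "\<exists>p. (p, x) \<in> skeleton1 X \<and> (p, y) \<in> skeleton1 X \<and> gdist (skeleton1 X) v p \<le> i"
proof -
  let ?T = "{w \<in> gball (vertices X) (skeleton1 X) i v. \<forall>z\<in>{x, y}. (w, z) \<in> skeleton1 X}"
  have "{x, y} \<in> X" using xy unfolding skeleton1_def by simp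
  moreover have "{x, y} \<subseteq> gsphere (vertices X) (skeleton1 X) (i + 1) v"
    using assms xy skeleton1_sym skeleton1_vertices unfolding gsphere_def by fastforce
  ultimately have "?T \<noteq> {}"
    by (intro weakly_systolic_common_neighbours[OF X v]) auto
  then show ?thesis unfolding gball_def by blast
qed

text \<open>The edges at \<open>v\<close> are among the finitely many simplices containing
  \<open>v\<close>. This is what makes an infinite search reach every vertex.\<close>

lemma finite_neighbours:
  assumes "locally_finite_complex X"
  shows "finite {x. (v, x) \<in> skeleton1 X}"
proof (cases "v \<in> vertices X")
  case True
  have "inj_on (\<lambda>x. {v, x}) {x. (v, x) \<in> skeleton1 X}"
    by (auto simp: inj_on_def doubleton_eq_iff)
  moreover have "(\<lambda>x. {v, x}) ` {x. (v, x) \<in> skeleton1 X} \<subseteq> {\<sigma> \<in> X. v \<in> \<sigma>}"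
    unfolding skeleton1_def by auto
  ultimately show ?thesis
    using assms True unfolding locally_finite_complex_def by (blast intro: inj_on_finite)
next
  case False
  then have "{x. (v, x) \<in> skeleton1 X} = {}" using skeleton1_vertices by fast
  then show ?thesis by simp
qed

section \<open>LexBFS orderings\<close>

lemma positions_less: "m \<in> positions V \<Longrightarrow> i < m \<Longrightarrow> i \<in> positions V"
  unfolding positions_def by auto

lemma lexbfs_ordering_in: "lexbfs_ordering V E u \<Longrightarrow> m \<in> positions V \<Longrightarrow> u m \<in> V"
  unfolding lexbfs_ordering_def by blast

lemma lexbfs_ordering_inj:
  assumes "lexbfs_ordering V E u"
  shows "inj_on u (positions V)"
proof (rule linorder_inj_onI)
  fix i j assume "i < j" "j \<in> positions V"
  then have "u j \<notin> u ` {..<j}" using assms unfolding lexbfs_ordering_def by blast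
  then show "u i \<noteq> u j" using \<open>i < j\<close> by (metis imageI lessThan_iff)
qed auto

text \<open>The labels of \<open>w\<close> and \<open>u m\<close> differ at \<open>u i\<close>, so
  that of \<open>u m\<close> is the larger one, and its first advantage \<open>k\<close> must come
  before \<open>i\<close>.\<close>

lemma lexbfs_ordering_choice:
  assumes L: "lexbfs_ordering V E u" and m: "m \<in> positions V"
    and w: "w \<in> V" "w \<notin> u ` {..<m}"
    and i: "i < m" "(u i, w) \<in> E" "(u i, u m) \<notin> E"
  shows "\<exists>k<i. (u k, u m) \<in> E \<and> (u k, w) \<notin> E"
proof -
  have lab: "set (lexbfs_label E u m x) = {u j |j. j < m \<and> (u j, x) \<in> E}" for x
    unfolding lexbfs_label_def by auto
  have diff: "u i \<in> set (lexbfs_label E u m w)" "u i \<notin> set (lexbfs_label E u m (u m))"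
    using i unfolding lab by auto
  then have "label_larger u (lexbfs_label E u m (u m)) (lexbfs_label E u m w)"
    using L m w diff unfolding lexbfs_ordering_def by (metis DiffI)
  then obtain k where
    k: "u k \<in> set (lexbfs_label E u m (u m))" "u k \<notin> set (lexbfs_label E u m w)"
    "\<forall>j<k. u j \<in> set (lexbfs_label E u m (u m)) \<longleftrightarrow> u j \<in> set (lexbfs_label E u m w)"
    unfolding label_larger_def by (elim exE conjE) (rule that)
  have um: "(u k, u m) \<in> E" and nw: "(u k, w) \<notin> E" using k(1,2) unfolding lab by auto
  have "\<not> i < k" "i \<noteq> k" using k diff by auto
  then show ?thesis using um nw by (intro exI[of _ k]) simp
qed

lemma rtrancl_leaves_set:
  assumes "(x, y) \<in> r\<^sup>*" "x \<in> S" "y \<notin> S"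
  shows "\<exists>p q. (p, q) \<in> r \<and> p \<in> S \<and> q \<notin> S"
  using assms by (induction rule: rtrancl_induct) blast+

text \<open>If \<open>q\<close> is never visited but has the visited neighbour \<open>u j\<close>, then all vertices visited
  after \<open>u j\<close> are adjacent to one of \<open>u 0, \<dots>, u j\<close>.\<close>

lemma lexbfs_ordering_visits_all:
  assumes L: "lexbfs_ordering V E u"
    and connected: "\<And>x y. x \<in> V \<Longrightarrow> y \<in> V \<Longrightarrow> (x, y) \<in> E\<^sup>*"
    and E: "\<And>x y. (x, y) \<in> E \<Longrightarrow> y \<in> V"
    and fin: "\<And>x. finite {y. (x, y) \<in> E}"
  shows "u ` positions V = V"
proof (cases "finite V")
  case True
  have "card (u ` positions V) = card V"
    using card_image[OF lexbfs_ordering_inj[OF L]] True by (simp add: positions_def)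
  then show ?thesis
    using True lexbfs_ordering_in[OF L] by (intro card_subset_eq) auto
next
  case False
  then have pos: "positions V = UNIV" unfolding positions_def by simp
  have inj: "inj u" using lexbfs_ordering_inj[OF L] pos by simp
  have sub: "range u \<subseteq> V" using lexbfs_ordering_in[OF L] pos by auto
  have "V \<subseteq> range u"
  proof (rule ccontr)
    assume "\<not> V \<subseteq> range u"
    then obtain x where "x \<in> V" "x \<notin> range u" by blast
    then obtain p q where pq: "(p, q) \<in> E" "p \<in> range u" "q \<notin> range u"
      using rtrancl_leaves_set[OF connected[of "u 0" x], of "range u"] sub by blast
    obtain j where j: "p = u j" using pq by blast
    \<comment> \<open>The unvisited \<open>q\<close> has \<open>u j\<close> in its label, so any
      \<open>u m\<close> preferred to it is adjacent to \<open>u j\<close> or to an earlier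
      vertex.\<close>
    have near: "u m \<in> (\<Union>i\<le>j. {y. (u i, y) \<in> E})" if jm: "j < m" for m
    proof (cases "(u j, u m) \<in> E")
      case False
      then obtain k where "k < j" "(u k, u m) \<in> E"
        using lexbfs_ordering_choice[OF L _ E[OF pq(1)] _ jm] pq j pos by auto
      then show ?thesis by (intro UN_I[of k]) auto
    qed auto
    have "u ` {j<..} \<subseteq> (\<Union>i\<le>j. {y. (u i, y) \<in> E})" using near by auto
    then have "finite (u ` {j<..})" using fin finite_subset by blast
    then have "finite {j<..}" using finite_imageD inj inj_on_subset by blast
    then show False using infinite_Ioi by blast
  qed
  then show ?thesis using sub pos by blast
qed

text \<open>Adjacency is restricted to \<open>P\<close> because the values of \<open>u\<close> at
  other indices are arbitrary and may repeat vertices.\<close>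

lemma lexbfs_graph_of_weakly_systolic:
  assumes X: "weakly_systolic X"
    and L: "lexbfs_ordering (vertices X) (skeleton1 X) u"
    and bij: "bij_betw u (positions (vertices X)) (vertices X)"
    and ne: "vertices X \<noteq> {}"
  defines "P \<equiv> positions (vertices X)"
  shows "lexbfs_graph P (\<lambda>i j. i \<in> P \<and> j \<in> P \<and> (u i, u j) \<in> skeleton1 X)
    (\<lambda>i j. gdist (skeleton1 X) (u i) (u j))"
proof -
  have uV: "u i \<in> vertices X" if "i \<in> P" for i
    using lexbfs_ordering_in[OF L] that unfolding P_def by blast
  have inj: "inj_on u P" using lexbfs_ordering_inj[OF L] unfolding P_def .
  have index: "\<exists>i\<in>P. x = u i" if "(x, y) \<in> skeleton1 X" for x y
    using skeleton1_vertices[OF that] bij unfolding P_def bij_betw_def by blast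
  have conn: "(u i, u j) \<in> (skeleton1 X)\<^sup>*" if "i \<in> P" "j \<in> P" for i j
    using weakly_systolic_connected[OF X] uV that by blast
  show ?thesis
  proof
    show "0 \<in> P" using ne unfolding P_def positions_def by (auto simp: card_gt_0_iff)
    show "x = y" if "x \<in> P" "y \<in> P" "gdist (skeleton1 X) (u x) (u y) = 0" for x y
      using gdist_eq_0D[OF conn] inj that by (blast dest: inj_onD)
    show "gdist (skeleton1 X) (u v) (u y) \<le> gdist (skeleton1 X) (u v) (u x) + 1"
      if "v \<in> P" "x \<in> P \<and> y \<in> P \<and> (u x, u y) \<in> skeleton1 X" for v x y
      using gdist_step[OF conn] that by blast
    show "\<exists>p. (p \<in> P \<and> x \<in> P \<and> (u p, u x) \<in> skeleton1 X) \<and> gdist (skeleton1 X) (u v) (u p) = i"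
      if "v \<in> P" "x \<in> P" "gdist (skeleton1 X) (u v) (u x) = Suc i" for v x i
      using gdist_pred[OF conn that(3)] index that by metis
    show "p = q \<or> (p \<in> P \<and> q \<in> P \<and> (u p, u q) \<in> skeleton1 X)"
      if v: "v \<in> P" and x: "gdist (skeleton1 X) (u v) (u x) = Suc i"
        and p: "p \<in> P \<and> x \<in> P \<and> (u p, u x) \<in> skeleton1 X"
        and q: "q \<in> P \<and> x \<in> P \<and> (u q, u x) \<in> skeleton1 X"
        and "gdist (skeleton1 X) (u v) (u p) \<le> i" "gdist (skeleton1 X) (u v) (u q) \<le> i"
      for v x i p q
    proof -
      have "u p = u q \<or> (u p, u q) \<in> skeleton1 X"
        using weakly_systolic_clique[OF X uV[OF v] x _ _ that(5,6)] p q by simp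
      then show ?thesis using inj p q by (meson inj_onD)
    qed
    show "\<exists>p. (p \<in> P \<and> x \<in> P \<and> (u p, u x) \<in> skeleton1 X) \<and>
        (p \<in> P \<and> y \<in> P \<and> (u p, u y) \<in> skeleton1 X) \<and> gdist (skeleton1 X) (u v) (u p) \<le> i"
      if v: "v \<in> P" and xy: "x \<in> P \<and> y \<in> P \<and> (u x, u y) \<in> skeleton1 X"
        and d: "gdist (skeleton1 X) (u v) (u x) = Suc i" "gdist (skeleton1 X) (u v) (u y) = Suc i"
      for v x y i
    proof -
      obtain z where z: "(z, u x) \<in> skeleton1 X" "(z, u y) \<in> skeleton1 X"
        "gdist (skeleton1 X) (u v) z \<le> i"
        using weakly_systolic_triangle[OF X uV[OF v] _ d] xy by blast
      then obtain p where "p \<in> P" "z = u p" using index by blast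
      then show ?thesis using z xy by blast
    qed
    show "\<exists>k<i. (k \<in> P \<and> p \<in> P \<and> (u k, u p) \<in> skeleton1 X) \<and>
        \<not> (k \<in> P \<and> q \<in> P \<and> (u k, u q) \<in> skeleton1 X)"
      if p: "p \<in> P" "p < q" "i < p" and q: "i \<in> P \<and> q \<in> P \<and> (u i, u q) \<in> skeleton1 X"
        and "\<not> (i \<in> P \<and> p \<in> P \<and> (u i, u p) \<in> skeleton1 X)" for p q i
    proof -
      have down: "j \<in> P" if "j < p" for j
        using positions_less p(1) that unfolding P_def by blast
      have "u q \<notin> u ` {..<p}"
        using inj q down p(2) by (auto dest!: inj_onD)
      moreover have "(u i, u p) \<notin> skeleton1 X" using that by blast
      ultimately obtain k where "k < i" "(u k, u p) \<in> skeleton1 X" "(u k, u q) \<notin> skeleton1 X"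
        using lexbfs_ordering_choice[OF L, of p "u q" i] p q uV unfolding P_def by blast
      then show ?thesis using down p by (meson less_trans)
    qed
  qed (auto simp: gdist_refl skeleton1_irrefl intro: skeleton1_sym)
qed

theorem theoremB:
  fixes X :: "'a set set" and u :: "nat \<Rightarrow> 'a"
  assumes "weakly_systolic X"
    and "locally_finite_complex X"
    and "lexbfs_ordering (vertices X) (skeleton1 X) u"
  shows "dismantling_ordering (vertices X) (skeleton1 X) u"
proof -
  let ?V = "vertices X" and ?E = "skeleton1 X"
  let ?P = "positions ?V"
  have "u ` ?P = ?V"
    using lexbfs_ordering_visits_all[OF assms(3)] weakly_systolic_connected[OF assms(1)]
      finite_neighbours[OF assms(2)] skeleton1_sym skeleton1_vertices by metis
  then have bij: "bij_betw u ?P ?V"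
    using lexbfs_ordering_inj[OF assms(3)] unfolding bij_betw_def by blast
  moreover have "\<exists>j<m. gball ?V ?E 1 (u m) \<inter> u ` {..m} \<subseteq> gball ?V ?E 1 (u j) \<inter> u ` {..m}"
    if m: "m \<in> ?P" "1 \<le> m" for m
  proof -
    have ne: "?V \<noteq> {}" using m bij unfolding bij_betw_def by blast
    interpret lexbfs_graph ?P "\<lambda>i j. i \<in> ?P \<and> j \<in> ?P \<and> (u i, u j) \<in> ?E"
      "\<lambda>i j. gdist ?E (u i) (u j)"
      using lexbfs_graph_of_weakly_systolic[OF assms(1,3) bij ne] .
    \<comment> \<open>The dominating position is the earliest neighbour. Points of the ball about
      \<open>u m\<close> are \<open>u m\<close> itself, handled by adjacency, and earlier
      neighbours, handled by \<open>father_dominates\<close>.\<close>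
    let ?f = "father m"
    have f: "(u ?f, u m) \<in> ?E" "?f < m" using father[OF m(1)] m(2) by auto
    have "gdist ?E (u ?f) (u i) \<le> 1" if i: "i \<le> m" "gdist ?E (u m) (u i) \<le> 1" for i
    proof (cases "i = m")
      case True
      then show ?thesis using gdist_adj f(1) by simp
    next
      case False
      then have im: "i < m" using i by simp
      have iP: "i \<in> ?P" using positions_less[OF m(1) im] .
      have "(u m, u i) \<in> ?E" using d_le_1[OF m(1) iP i(2)] False by simp
      then have "i = ?f \<or> (u i, u ?f) \<in> ?E"
        using father_dominates[OF m(1) im] skeleton1_sym[of "u m"] m(1) iP by auto
      then show ?thesis
        using gdist_adj[OF skeleton1_sym] gdist_refl[of ?E "u i"] by auto
    qed
    then have "gball ?V ?E 1 (u m) \<inter> u ` {..m} \<subseteq> gball ?V ?E 1 (u ?f) \<inter> u ` {..m}"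
      unfolding gball_def by auto
    then show ?thesis using f(2) by blast
  qed
  ultimately show ?thesis unfolding dismantling_ordering_def by blast
qed

end
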